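(* Let $1<p<\infty$ and $p^*=\max\left(p,\frac{p}{p-1}\right)$. For every complex stretch $g$, i.e. every smooth compactly supported function $g:[0,\infty)\to\mathbb{C}$ with $g(0)=0$, $$\int_0^\infty\left|g'(r)-\frac{g(r)}{r}\right|^p r\,dr\le (p^*-1)^p\int_0^\infty\left|g'(r)+\frac{g(r)}{r}\right|^p r\,dr .$$
   Context: Compact support is meant in $[0,\infty)$, so that $g$ vanishes for all large $r$. *)

theory Defs
  imports "HOL-Analysis.Analysis"
begin

text \<open>
  The type of \<open>g\<close> is \<open>real \<Rightarrow> complex\<close>, but only its values on \<open>[0,\<infinity>)\<close> matter: all derivatives are
  taken within the half-line, so they are one-sided at \<open>0\<close> and two-sided at \<open>r > 0\<close>.
\<close>

definition deriv_halfline :: "(real \<Rightarrow> complex) \<Rightarrow> real \<Rightarrow> complex" where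
  "deriv_halfline g r = vector_derivative g (at r within {0..})"

definition smooth_halfline :: "(real \<Rightarrow> complex) \<Rightarrow> bool" where
  "smooth_halfline g \<longleftrightarrow> (\<forall>n. (deriv_halfline ^^ n) g differentiable_on {0..})"

definition complex_stretch :: "(real \<Rightarrow> complex) \<Rightarrow> bool" where
  "complex_stretch g \<longleftrightarrow>
     smooth_halfline g \<and> compact (closure (support_on {0..} g)) \<and> g 0 = 0"

lemma compact_support_halfline_iff:
  "compact (closure (support_on {0..} g)) \<longleftrightarrow> (\<exists>R. \<forall>r\<ge>0. r > R \<longrightarrow> g r = 0)"
  for g :: "real \<Rightarrow> complex"
proof
  assume "compact (closure (support_on {0..} g))"
  then have "bounded (support_on {0..} g)" by simp
  then obtain R where "\<forall>x\<in>support_on {0..} g. norm x \<le> R" by (auto simp: bounded_iff)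
  then show "\<exists>R. \<forall>r\<ge>0. r > R \<longrightarrow> g r = 0"
    by (intro exI[of _ R]) (force simp: support_on_def)
next
  assume "\<exists>R. \<forall>r\<ge>0. r > R \<longrightarrow> g r = 0"
  then obtain R where "\<forall>r\<ge>0. r > R \<longrightarrow> g r = 0" by blast
  then have "\<forall>x\<in>support_on {0..} g. norm x \<le> R" by (force simp: support_on_def)
  then show "compact (closure (support_on {0..} g))" by (auto simp: bounded_iff)
qed

definition conj_max :: "real \<Rightarrow> real" where
  "conj_max p = max p (p / (p - 1))"

end

theory Submission
  imports Defs
begin

text \<open>
  Write \<open>a = g'\<close> and \<open>b = g / r\<close>, and let \<open>a \<bullet> b\<close> be the real inner product on \<open>\<complex>\<close>. The function
  \<open>|g|\<^sup>p r\<^bsup>2-p\<^esup>\<close> is \<open>O(r\<^sup>2)\<close> at \<open>0\<close>, since \<open>g 0 = 0\<close>, and vanishes for large \<open>r\<close>. Its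
  derivative is \<open>(p |b|\<^bsup>p-2\<^esup> (b \<bullet> a) + (2 - p) |b|\<^sup>p) r\<close>, so this expression has integral \<open>0\<close> over the
  half-line (\<open>null_lagrangian_has_integral\<close>). It therefore suffices to find a constant \<open>K\<close>, depending
  on \<open>p\<close> only, with the pointwise bound (\<open>stretch_pointwise\<close>)
  \<open>|a - b|\<^sup>p - (p\<^sup>* - 1)\<^sup>p |a + b|\<^sup>p \<le> - K (p |b|\<^bsup>p-2\<^esup> (b \<bullet> a) + (2 - p) |b|\<^sup>p)\<close> for all \<open>a, b\<close>:
  multiply by \<open>r\<close> and integrate.

  By homogeneity \<open>|b| = 1\<close>. Put \<open>x = |a + b|\<close> and \<open>y = |a - b|\<close>; by the parallelogram-type identity
  \<open>x\<^sup>2 - y\<^sup>2 = 4 (b \<bullet> a)\<close> the bound is one about two real numbers with \<open>x + y \<ge> 2 \<ge> |x - y|\<close>. Two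
  elementary inequalities give it. Burkholder's inequality (\<open>burkholder_tangent\<close>) replaces the left
  side by a multiple of \<open>(y - (p\<^sup>* - 1) x) (x + y)\<^bsup>p-1\<^esup>\<close>, which is linear in \<open>x - y\<close> once \<open>x + y\<close> is
  fixed. When \<open>x + y = 2\<close> (\<open>a\<close> a real multiple of \<open>b\<close>, no longer than \<open>b\<close>) and \<open>p \<le> 2\<close> this is
  precisely the right side. The passage to \<open>x + y \<ge> 2\<close>, and for \<open>p \<ge> 2\<close> the change of sign of
  the coefficient \<open>2 - p\<close>, is controlled by the monotonicity of
  \<open>(2 - p) s\<^sup>p + p s\<^bsup>p-1\<^esup> - p s\<close> on \<open>s \<ge> 1\<close> (\<open>powr_combination_monotone\<close>). Both inequalities reverse
  at \<open>p = 2\<close>; the two ranges of \<open>p\<close> are treated together by means of a sign \<open>e\<close>, equal to \<open>1\<close> for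
  \<open>p \<ge> 2\<close> and to \<open>-1\<close> for \<open>p \<le> 2\<close>.
\<close>

section \<open>One-variable inequalities\<close>

text \<open>
  Since \<open>f''\<close> is decreasing, \<open>f\<close> is first convex and then concave, and \<open>c\<close> lies in the concave part.
  There \<open>f\<close> stays below its tangent at \<open>c\<close>, which is \<open>0\<close>; on the convex part \<open>f\<close> is at most the
  larger of its values at the two ends. The proof finds no inflection point: a positive value left
  of \<open>c\<close> would make \<open>f\<close> rise, fall and become stationary at \<open>c\<close>, so that \<open>f''\<close> would be negative
  and later positive.
\<close>

lemma nonpos_if_second_derivative_antimono:
  fixes f f' f'' :: "real \<Rightarrow> real"
  assumes cont: "continuous_on {0..1} f"
    and d1: "\<And>u. 0 < u \<Longrightarrow> u < 1 \<Longrightarrow> (f has_real_derivative f' u) (at u)"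
    and d2: "\<And>u. 0 < u \<Longrightarrow> u < 1 \<Longrightarrow> (f' has_real_derivative f'' u) (at u)"
    and anti: "\<And>u v. 0 < u \<Longrightarrow> u \<le> v \<Longrightarrow> v < 1 \<Longrightarrow> f'' v \<le> f'' u"
    and c: "0 < c" "c < 1" "f c = 0" "f' c = 0" "f'' c \<le> 0"
    and zero: "f 0 \<le> 0"
    and u: "0 \<le> u" "u \<le> 1"
  shows "f u \<le> 0"
proof (rule ccontr)
  assume neg: "\<not> f u \<le> 0"
  have mvt: "\<exists>z>a. z < b \<and> f b - f a = (b - a) * f' z" if "0 \<le> a" "a < b" "b \<le> 1" for a b
  proof -
    have "continuous_on {a..b} f"
      using cont that by (auto intro: continuous_on_subset)
    moreover have "f differentiable (at z)" if "a < z" "z < b" for z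
      using d1[of z] that \<open>0 \<le> a\<close> \<open>b \<le> 1\<close> by (auto simp: real_differentiable_def)
    ultimately obtain l z where z: "a < z" "z < b" "(f has_real_derivative l) (at z)"
      "f b - f a = (b - a) * l"
      using MVT[OF \<open>a < b\<close>] by blast
    moreover have "l = f' z"
      using DERIV_unique[OF z(3) d1] z that by auto
    ultimately show ?thesis by auto
  qed
  have mvt': "\<exists>z>a. z < b \<and> f' b - f' a = (b - a) * f'' z" if "0 < a" "a < b" "b < 1" for a b
    using MVT2[of a b f' f''] d2 that by auto
  consider "u < c" | "u > c" using neg c by fastforce
  then show False
  proof cases
    case 1
    with neg zero u have "0 < u" by (cases "u = 0") auto
    obtain v where v: "0 < v" "v < u" "f u - f 0 = (u - 0) * f' v"
      using mvt[of 0 u] \<open>0 < u\<close> u by auto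
    obtain w where w: "u < w" "w < c" "f c - f u = (c - u) * f' w"
      using mvt[of u c] 1 u c by auto
    have "u * f' v > 0" "(c - u) * f' w < 0"
      using v w neg zero c by auto
    then have s: "f' v > 0" "f' w < 0"
      using \<open>0 < u\<close> 1 by (auto simp: zero_less_mult_iff mult_less_0_iff)
    obtain y where y: "v < y" "y < w" "f' w - f' v = (w - v) * f'' y"
      using mvt'[of v w] v w c by auto
    obtain z where z: "w < z" "z < c" "f' c - f' w = (c - w) * f'' z"
      using mvt'[of w c] v w c by auto
    have "(w - v) * f'' y < 0" "(c - w) * f'' z > 0"
      using y z s c by auto
    then have "f'' y < 0" "f'' z > 0"
      using v w by (auto simp: zero_less_mult_iff mult_less_0_iff)
    then show False using anti[of y z] y z v w c by auto
  next
    case 2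
    obtain v where v: "c < v" "v < u" "f u - f c = (u - c) * f' v"
      using mvt[of c u] 2 u c by auto
    have "(u - c) * f' v > 0" using v neg c by auto
    then have "f' v > 0" using 2 by (auto simp: zero_less_mult_iff)
    obtain z where z: "c < z" "z < v" "f' v - f' c = (v - c) * f'' z"
      using mvt'[of c v] v u c by auto
    have "(v - c) * f'' z > 0" using z \<open>f' v > 0\<close> c by auto
    then have "f'' z > 0" using v by (auto simp: zero_less_mult_iff)
    then show False using anti[of c z] z v u c by auto
  qed
qed

lemma Bernoulli_powr_le:
  fixes x r :: real
  assumes "0 < x" "0 \<le> r" "r \<le> 1"
  shows "x powr r \<le> 1 + r * (x - 1)"
  using Youngs_inequality_0[of r "1 - r" x 1] assms by (simp add: algebra_simps)

text \<open>
  An exponent \<open>r \<ge> 1\<close> reduces to the concave exponent \<open>1 / r\<close>; a negative one to \<open>ln x \<le> x - 1\<close>.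
\<close>

lemma Bernoulli_powr_ge:
  fixes x r :: real
  assumes x: "0 < x" and r: "r \<le> 0 \<or> 1 \<le> r"
  shows "1 + r * (x - 1) \<le> x powr r"
  using r
proof
  assume "r \<le> 0"
  then have "r * (x - 1) \<le> r * ln x"
    using ln_le_minus_one[OF x] by (simp add: mult_left_mono_neg)
  also have "1 + r * ln x \<le> x powr r"
    using x by (simp add: powr_def)
  finally show ?thesis by simp
next
  assume r: "1 \<le> r"
  show ?thesis
  proof (cases "0 < 1 + r * (x - 1)")
    case True
    have "(1 + r * (x - 1)) powr (1 / r) \<le> 1 + 1 / r * (1 + r * (x - 1) - 1)"
      using True r by (intro Bernoulli_powr_le) auto
    also have "\<dots> = x" using r by simp
    finally have "((1 + r * (x - 1)) powr (1 / r)) powr r \<le> x powr r"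
      using r by (intro powr_mono2) auto
    then show ?thesis using True r by (simp add: powr_powr)
  next
    case False
    then show ?thesis using powr_ge_zero[of x r] by linarith
  qed
qed

section \<open>Burkholder's inequality\<close>

text \<open>
  The constant makes the line \<open>burkholder_const p * (1 - p * u)\<close> tangent to
  \<open>(1 - u)\<^sup>p - (p - 1)\<^sup>p u\<^sup>p\<close> at its zero \<open>u = 1 / p\<close>.
\<close>

definition burkholder_const :: "real \<Rightarrow> real" where
  "burkholder_const p = p * ((p - 1) / p) powr (p - 1)"

text \<open>
  The difference of the curve and its tangent, times \<open>e\<close>, has a decreasing second derivative. Its
  value at \<open>0\<close> is \<open>e * (1 - burkholder_const p)\<close>, whose sign is Bernoulli's inequality with exponent
  \<open>p - 1\<close> at the point \<open>(p - 1) / p\<close>; the direction of that inequality changes at \<open>p = 2\<close>.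
\<close>

lemma burkholder_tangent_unit:
  fixes p e u :: real
  assumes p: "1 < p" and e: "e = 1 \<and> 2 \<le> p \<or> e = -1 \<and> p \<le> 2"
    and u: "0 \<le> u" "u \<le> 1"
  shows "e * ((1 - u) powr p - (p - 1) powr p * u powr p - burkholder_const p * (1 - p * u)) \<le> 0"
proof -
  define \<alpha> where "\<alpha> = burkholder_const p"
  define f where "f u = e * ((1 - u) powr p - (p - 1) powr p * u powr p - \<alpha> * (1 - p * u))" for u
  define f' where "f' u = e * (p * (\<alpha> - (1 - u) powr (p - 1) - (p - 1) powr p * u powr (p - 1)))" for u
  define f'' where "f'' u = p * (p - 1) * (e * ((1 - u) powr (p - 2) - (p - 1) powr p * u powr (p - 2)))" for u
  have "f u \<le> 0"
  proof (rule nonpos_if_second_derivative_antimono[where f = f and u = u and c = "1 / p" and f' = f' and f'' = f''])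
    show "continuous_on {0..1} f"
      unfolding f_def using p by (intro continuous_intros continuous_on_powr') auto
    show "(f has_real_derivative f' u) (at u)" if "0 < u" "u < 1" for u
      unfolding f_def f'_def using that p
      by (auto intro!: derivative_eq_intros simp: algebra_simps)
    show "(f' has_real_derivative f'' u) (at u)" if "0 < u" "u < 1" for u
      unfolding f'_def f''_def using that p
      by (auto intro!: derivative_eq_intros simp: algebra_simps)
    show "f'' v \<le> f'' u" if uv: "0 < u" "u \<le> v" "v < 1" for u v
    proof -
      have "e * ((1 - v) powr (p - 2) - (p - 1) powr p * v powr (p - 2))
          \<le> e * ((1 - u) powr (p - 2) - (p - 1) powr p * u powr (p - 2))"
        using e
      proof
        assume *: "e = 1 \<and> 2 \<le> p"
        have A: "(1 - v) powr (p - 2) \<le> (1 - u) powr (p - 2)"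
          using * uv by (intro powr_mono2) auto
        have B: "(p - 1) powr p * u powr (p - 2) \<le> (p - 1) powr p * v powr (p - 2)"
          using * uv by (intro mult_left_mono powr_mono2) auto
        from diff_mono[OF A B] show ?thesis using * by simp
      next
        assume *: "e = -1 \<and> p \<le> 2"
        have A: "(1 - u) powr (p - 2) \<le> (1 - v) powr (p - 2)"
          using * uv by (intro powr_mono2') auto
        have B: "(p - 1) powr p * v powr (p - 2) \<le> (p - 1) powr p * u powr (p - 2)"
          using * uv by (intro mult_left_mono powr_mono2') auto
        from diff_mono[OF A B] show ?thesis using * by simp
      qed
      then show ?thesis unfolding f''_def by (rule mult_left_mono) (use p in simp)
    qed
    have q: "1 - 1 / p = (p - 1) / p" using p by (simp add: field_simps)
    have pp: "(p - 1) powr p = (p - 1) * (p - 1) powr (p - 1)"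
      using p powr_add[of "p - 1" 1 "p - 1"] by simp
    show "0 < 1 / p" "1 / p < 1" using p by auto
    show "f (1 / p) = 0"
      unfolding f_def q using p by (simp add: powr_divide)
    show "f' (1 / p) = 0"
      unfolding f'_def q \<alpha>_def burkholder_const_def using p
      by (simp add: powr_divide pp field_simps)
    show "f'' (1 / p) \<le> 0"
    proof -
      have "(p - 1) powr p * (1 / p) powr (p - 2)
          = (p - 1)\<^sup>2 * ((p - 1) / p) powr (p - 2)"
        using p powr_add[of "p - 1" 2 "p - 2"] by (simp add: powr_divide)
      then have *: "f'' (1 / p) = p * (p - 1) * ((e * (1 - (p - 1)\<^sup>2)) * ((p - 1) / p) powr (p - 2))"
        unfolding f''_def q using p by (simp add: algebra_simps)
      have "e * (1 - (p - 1)\<^sup>2) \<le> 0"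
        using e p by (auto simp: power_le_one)
      then have "(e * (1 - (p - 1)\<^sup>2)) * ((p - 1) / p) powr (p - 2) \<le> 0"
        by (simp add: mult_nonpos_nonneg)
      then show ?thesis unfolding * using p by (simp add: mult_nonneg_nonpos)
    qed
    show "f 0 \<le> 0"
    proof -
      have b: "p * (1 + (p - 1) * ((p - 1) / p - 1)) = 1"
        using p by (simp add: field_simps)
      have "e * (1 - \<alpha>) \<le> 0"
        using e
      proof
        assume *: "e = 1 \<and> 2 \<le> p"
        have "1 + (p - 1) * ((p - 1) / p - 1) \<le> ((p - 1) / p) powr (p - 1)"
          using * p by (intro Bernoulli_powr_ge) auto
        from mult_left_mono[OF this, of p] show ?thesis
          using * p b by (simp add: \<alpha>_def burkholder_const_def)
      next
        assume *: "e = -1 \<and> p \<le> 2"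
        have "((p - 1) / p) powr (p - 1) \<le> 1 + (p - 1) * ((p - 1) / p - 1)"
          using * p by (intro Bernoulli_powr_le) auto
        from mult_left_mono[OF this, of p] show ?thesis
          using * p b by (simp add: \<alpha>_def burkholder_const_def)
      qed
      then show ?thesis unfolding f_def using p by simp
    qed
  qed (use u in auto)
  then show ?thesis by (simp add: f_def \<alpha>_def)
qed

text \<open>
  For \<open>p \<ge> 2\<close> this compares \<open>y\<close> with \<open>p - 1\<close> times \<open>x\<close>. For \<open>p \<le> 2\<close> the sign reverses the inequality,
  and after exchanging \<open>x\<close> and \<open>y\<close> and dividing by \<open>(p - 1)\<^sup>p\<close> it compares \<open>y\<close> with
  \<open>1 / (p - 1)\<close> times \<open>x\<close>: in both cases the factor is the conjugate maximum minus \<open>1\<close>.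
\<close>

lemma burkholder_tangent:
  fixes p e x y :: real
  assumes p: "1 < p" and e: "e = 1 \<and> 2 \<le> p \<or> e = -1 \<and> p \<le> 2"
    and xy: "0 \<le> x" "0 \<le> y" "0 < x + y"
  shows "e * (y powr p - (p - 1) powr p * x powr p)
       \<le> e * (burkholder_const p * (y - (p - 1) * x) * (x + y) powr (p - 1))"
proof -
  define s where "s = x + y"
  have s: "s > 0" using xy by (simp add: s_def)
  define u where "u = x / s"
  have y: "y = s * (1 - u)" "x = s * u" using s by (auto simp: u_def s_def field_simps)
  have u: "0 \<le> u" "u \<le> 1" using xy s by (auto simp: u_def s_def)
  have sp: "s powr p = s * s powr (p - 1)"
    using s powr_add[of s 1 "p - 1"] by simp
  have yp: "y powr p = s powr p * (1 - u) powr p" "x powr p = s powr p * u powr p"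
    using s u by (simp_all add: y powr_mult)
  have "e * (y powr p - (p - 1) powr p * x powr p)
       - e * (burkholder_const p * (y - (p - 1) * x) * (x + y) powr (p - 1))
      = s powr p * (e * ((1 - u) powr p - (p - 1) powr p * u powr p
          - burkholder_const p * (1 - p * u)))"
    unfolding yp unfolding s_def[symmetric] unfolding y sp by (simp add: algebra_simps)
  also have "\<dots> \<le> 0"
    using burkholder_tangent_unit[OF p e u] by (simp add: mult_nonneg_nonpos)
  finally show ?thesis by simp
qed

section \<open>The pointwise inequality\<close>

text \<open>
  The derivative of the bracket at \<open>t\<close> is \<open>p t\<^bsup>p-2\<^esup>\<close> times \<open>1 + (2 - p) (t - 1) - t\<^bsup>2-p\<^esup>\<close>, so its
  sign is Bernoulli's inequality with exponent \<open>2 - p\<close>, which is at most \<open>0\<close> or lies in \<open>[0, 1]\<close>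
  according to the range of \<open>p\<close>. The value at \<open>1\<close> is \<open>2 - p\<close>.
\<close>

lemma powr_combination_monotone:
  fixes p s e :: real
  assumes p: "1 < p" and e: "e = 1 \<and> 2 \<le> p \<or> e = -1 \<and> p \<le> 2" and s: "1 \<le> s"
  shows "e * ((2 - p) * s powr p + p * s powr (p - 1) - p * s) \<le> e * (2 - p)"
proof -
  define m where "m s = - e * ((2 - p) * s powr p + p * s powr (p - 1) - p * s)" for s
  have "m 1 \<le> m s"
  proof (rule DERIV_nonneg_imp_nondecreasing[OF s])
    fix t :: real assume t: "1 \<le> t" "t \<le> s"
    have tp: "t powr (p - 2) * t powr (2 - p) = 1" "t powr (p - 1) = t * t powr (p - 2)"
      using t powr_add[of t 1 "p - 2"] by (simp_all flip: powr_add)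
    define d where "d = - e * (p * ((2 - p) * t powr (p - 1) + (p - 1) * t powr (p - 2) - 1))"
    have "(m has_real_derivative d) (at t)"
      unfolding m_def d_def using t p
      by (auto intro!: derivative_eq_intros simp: algebra_simps)
    moreover have "d \<ge> 0"
    proof -
      have "d = p * (t powr (p - 2) * (e * (t powr (2 - p) - (1 + (2 - p) * (t - 1)))))"
        using tp(1) unfolding d_def tp(2) by (simp add: algebra_simps)
      moreover have "0 \<le> e * (t powr (2 - p) - (1 + (2 - p) * (t - 1)))"
        using e
      proof
        assume "e = 1 \<and> 2 \<le> p"
        then show ?thesis using Bernoulli_powr_ge[of t "2 - p"] t by auto
      next
        assume "e = -1 \<and> p \<le> 2"
        then show ?thesis using Bernoulli_powr_le[of t "2 - p"] t p by auto
      qed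
      ultimately show ?thesis using p by simp
    qed
    ultimately show "\<exists>y. (m has_real_derivative y) (at t) \<and> 0 \<le> y" by blast
  qed
  then show ?thesis by (simp add: m_def algebra_simps)
qed

text \<open>
  In terms of \<open>S = (x + y) / 2 \<ge> 1\<close> and \<open>D = (x - y) / 2\<close>, Burkholder's inequality bounds the left side
  by \<open>K (- |p - 2| S - p D) S\<^bsup>p-1\<^esup>\<close>, while the right side is \<open>K (p - 2 - p S D)\<close>. The difference of
  the two is affine in \<open>D\<close>, so only the least favourable end of \<open>[-1, 1]\<close> matters: \<open>D = -1\<close> for
  \<open>p \<ge> 2\<close>, where \<open>S\<^bsup>p-1\<^esup> \<ge> S\<close>, and \<open>D = 1\<close> for \<open>p \<le> 2\<close>.
\<close>

lemma stretch_pointwise_scalar: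
  fixes p :: real
  assumes p: "1 < p"
  obtains K where "\<And>x y. 0 \<le> x \<Longrightarrow> 0 \<le> y \<Longrightarrow> 2 \<le> x + y \<Longrightarrow> \<bar>x - y\<bar> \<le> 2 \<Longrightarrow>
    y powr p - (conj_max p - 1) powr p * x powr p \<le> - K * (p * (x\<^sup>2 - y\<^sup>2) / 4 + 2 - p)"
proof (cases "2 \<le> p")
  case True
  define K where "K = burkholder_const p * 2 powr (p - 1)"
  have K0: "0 \<le> K" using p by (simp add: K_def burkholder_const_def)
  have "p / (p - 1) \<le> p" using True by (simp add: divide_le_eq)
  then have cm: "conj_max p - 1 = p - 1" by (simp add: conj_max_def)
  have "y powr p - (conj_max p - 1) powr p * x powr p \<le> - K * (p * (x\<^sup>2 - y\<^sup>2) / 4 + 2 - p)"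
    if xy: "0 \<le> x" "0 \<le> y" "2 \<le> x + y" "\<bar>x - y\<bar> \<le> 2" for x y
  proof -
    define S D where "S = (x + y) / 2" and "D = (x - y) / 2"
    have S: "1 \<le> S" and D: "\<bar>D\<bar> \<le> 1" using xy by (auto simp: S_def D_def)
    have x: "x = S + D" and y: "y = S - D" by (auto simp: S_def D_def field_simps)
    have Sp: "S powr p = S * S powr (p - 1)" using S powr_add[of S 1 "p - 1"] by simp
    have Sge: "S \<le> S powr (p - 1)" using S True powr_mono[of 1 "p - 1" S] by simp
    have "p * (- D) * (S powr (p - 1) - S) \<le> p * 1 * (S powr (p - 1) - S)"
      using p D Sge by (intro mult_right_mono mult_left_mono) auto
    moreover have "(2 - p) * S powr p + p * S powr (p - 1) - p * S \<le> 2 - p"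
      using powr_combination_monotone[of p 1 S] p S True by simp
    ultimately have key: "((2 - p) * S - p * D) * S powr (p - 1) \<le> - (p * S * D + 2 - p)"
      using True unfolding Sp by (simp add: algebra_simps)
    have "y powr p - (p - 1) powr p * x powr p
        \<le> burkholder_const p * (y - (p - 1) * x) * (x + y) powr (p - 1)"
      using burkholder_tangent[of p 1 x y] p True xy by simp
    also have "\<dots> = K * (((2 - p) * S - p * D) * S powr (p - 1))"
    proof -
      have "x + y = 2 * S" by (simp add: S_def)
      then have "(x + y) powr (p - 1) = 2 powr (p - 1) * S powr (p - 1)"
        using S by (simp add: powr_mult)
      moreover have "y - (p - 1) * x = (2 - p) * S - p * D" by (simp add: x y algebra_simps)
      ultimately show ?thesis by (simp add: K_def)
    qed
    also have "\<dots> \<le> K * - (p * S * D + 2 - p)" by (rule mult_left_mono[OF key K0])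
    also have "p * S * D = p * (x\<^sup>2 - y\<^sup>2) / 4"
      by (simp add: x y power2_eq_square algebra_simps)
    finally show ?thesis by (simp only: cm mult_minus_left mult_minus_right)
  qed
  then show thesis by (rule that)
next
  case False
  define K where "K = (p - 1) powr (- p) * burkholder_const p * 2 powr (p - 1)"
  have K0: "0 \<le> K" using p by (simp add: K_def burkholder_const_def)
  have "p \<le> p / (p - 1)" using False p by (simp add: le_divide_eq)
  then have "conj_max p - 1 = 1 / (p - 1)" using p by (simp add: conj_max_def field_simps)
  then have cm: "(conj_max p - 1) powr p = (p - 1) powr (- p)"
    using p by (simp only: powr_divide powr_minus powr_one_eq_one inverse_eq_divide)
  have "y powr p - (conj_max p - 1) powr p * x powr p \<le> - K * (p * (x\<^sup>2 - y\<^sup>2) / 4 + 2 - p)"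
    if xy: "0 \<le> x" "0 \<le> y" "2 \<le> x + y" "\<bar>x - y\<bar> \<le> 2" for x y
  proof -
    define S D where "S = (x + y) / 2" and "D = (x - y) / 2"
    have S: "1 \<le> S" and D: "\<bar>D\<bar> \<le> 1" using xy by (auto simp: S_def D_def)
    have x: "x = S + D" and y: "y = S - D" by (auto simp: S_def D_def field_simps)
    have Sp: "S powr p = S * S powr (p - 1)" using S powr_add[of S 1 "p - 1"] by simp
    have Sle: "S powr (p - 1) \<le> S" using S False powr_mono[of "p - 1" 1 S] by simp
    have "p * D * (S - S powr (p - 1)) \<le> p * 1 * (S - S powr (p - 1))"
      using p D Sle by (intro mult_right_mono mult_left_mono) auto
    moreover have "2 - p \<le> (2 - p) * S powr p + p * S powr (p - 1) - p * S"
      using powr_combination_monotone[of p "-1" S] p S False by simp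
    ultimately have key: "((p - 2) * S - p * D) * S powr (p - 1) \<le> - (p * S * D + 2 - p)"
      unfolding Sp by (simp add: algebra_simps)
    have "(p - 1) powr p * y powr p - x powr p
        \<le> burkholder_const p * ((p - 1) * y - x) * (x + y) powr (p - 1)"
      using burkholder_tangent[of p "-1" y x] p False xy by (simp add: algebra_simps)
    from mult_left_mono[OF this, of "(p - 1) powr (- p)"]
    moreover have "(p - 1) powr (- p) * (p - 1) powr p = 1"
      using p by (simp flip: powr_add)
    ultimately have "y powr p - (p - 1) powr (- p) * x powr p
        \<le> (p - 1) powr (- p) * (burkholder_const p * ((p - 1) * y - x) * (x + y) powr (p - 1))"
      by (simp add: right_diff_distrib[of "(p - 1) powr (- p)"] flip: mult.assoc)
    also have "\<dots> = K * (((p - 2) * S - p * D) * S powr (p - 1))"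
    proof -
      have "x + y = 2 * S" by (simp add: S_def)
      then have "(x + y) powr (p - 1) = 2 powr (p - 1) * S powr (p - 1)"
        using S by (simp add: powr_mult)
      moreover have "(p - 1) * y - x = (p - 2) * S - p * D" by (simp add: x y algebra_simps)
      ultimately show ?thesis by (simp add: K_def)
    qed
    also have "\<dots> \<le> K * - (p * S * D + 2 - p)" by (rule mult_left_mono[OF key K0])
    also have "p * S * D = p * (x\<^sup>2 - y\<^sup>2) / 4"
      by (simp add: x y power2_eq_square algebra_simps)
    finally show ?thesis by (simp only: cm mult_minus_left mult_minus_right)
  qed
  then show thesis by (rule that)
qed

lemma conj_max_ge_2: "1 < p \<Longrightarrow> 2 \<le> conj_max p"
  by (cases "2 \<le> p") (auto simp: conj_max_def le_max_iff_disj le_divide_eq)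

text \<open>
  The claim is homogeneous of degree \<open>p\<close> in \<open>(a, b)\<close>; dividing by \<open>|b|\<close> leads to the scalar inequality.
  For \<open>b = 0\<close> it says that the conjugate maximum minus \<open>1\<close> is at least \<open>1\<close>.
\<close>

lemma stretch_pointwise:
  fixes p :: real
  assumes p: "1 < p"
  obtains K where "\<And>a b :: 'a :: real_inner.
    norm (a - b) powr p - (conj_max p - 1) powr p * norm (a + b) powr p
      \<le> - K * (p * norm b powr (p - 2) * inner b a + (2 - p) * norm b powr p)"
proof -
  obtain K where K: "\<And>x y. 0 \<le> x \<Longrightarrow> 0 \<le> y \<Longrightarrow> 2 \<le> x + y \<Longrightarrow> \<bar>x - y\<bar> \<le> 2 \<Longrightarrow>
    y powr p - (conj_max p - 1) powr p * x powr p \<le> - K * (p * (x\<^sup>2 - y\<^sup>2) / 4 + 2 - p)"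
    using stretch_pointwise_scalar[OF p] by blast
  have "norm (a - b) powr p - (conj_max p - 1) powr p * norm (a + b) powr p
      \<le> - K * (p * norm b powr (p - 2) * inner b a + (2 - p) * norm b powr p)" for a b :: 'a
  proof (cases "b = 0")
    case True
    have "1 \<le> (conj_max p - 1) powr p"
      using conj_max_ge_2[OF p] p by (intro ge_one_powr_ge_zero) auto
    then have "1 * norm a powr p \<le> (conj_max p - 1) powr p * norm a powr p"
      by (intro mult_right_mono) auto
    then show ?thesis using True p by simp
  next
    case False
    define \<beta> where "\<beta> = norm b"
    have \<beta>: "\<beta> > 0" using False by (simp add: \<beta>_def)
    define x y where "x = norm (a + b) / \<beta>" and "y = norm (a - b) / \<beta>"
    have xy0: "0 \<le> x" "0 \<le> y" using \<beta> by (auto simp: x_def y_def)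
    have "norm (2 *\<^sub>R b) \<le> norm (a + b) + norm (a - b)"
      using norm_triangle_ineq4[of "a + b" "a - b"] by (simp add: scaleR_2)
    then have xy1: "2 \<le> x + y" using \<beta> by (simp add: x_def y_def \<beta>_def field_simps)
    have "\<bar>norm (a + b) - norm (a - b)\<bar> \<le> norm (2 *\<^sub>R b)"
      using norm_triangle_ineq3[of "a + b" "a - b"] by (simp add: scaleR_2)
    then have xy2: "\<bar>x - y\<bar> \<le> 2"
      using \<beta> by (simp add: x_def y_def \<beta>_def field_simps flip: diff_divide_distrib)
    have n: "norm (a + b) = \<beta> * x" "norm (a - b) = \<beta> * y" using \<beta> by (auto simp: x_def y_def)
    have i: "\<beta>\<^sup>2 * ((x\<^sup>2 - y\<^sup>2) / 4) = inner b a"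
    proof -
      have "(norm (a + b))\<^sup>2 - (norm (a - b))\<^sup>2 = 4 * inner b a"
        by (simp add: power2_norm_eq_inner inner_simps inner_commute)
      then show ?thesis unfolding n by (simp add: power_mult_distrib algebra_simps)
    qed
    have \<beta>p: "\<beta> powr p = \<beta> powr (p - 2) * \<beta>\<^sup>2"
      using \<beta> powr_add[of \<beta> "p - 2" 2] by simp
    have "\<beta> powr p * (y powr p - (conj_max p - 1) powr p * x powr p)
        \<le> \<beta> powr p * (- K * (p * (x\<^sup>2 - y\<^sup>2) / 4 + 2 - p))"
      using K[OF xy0 xy1 xy2] by (rule mult_left_mono) simp
    also have "\<dots> = - K * (p * \<beta> powr (p - 2) * inner b a + (2 - p) * \<beta> powr p)"
      unfolding i[symmetric] \<beta>p by (simp add: algebra_simps)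
    finally show ?thesis
      unfolding n using \<beta> xy0 by (simp add: powr_mult \<beta>_def[symmetric] algebra_simps)
  qed
  then show thesis by (rule that)
qed


section \<open>The null Lagrangian\<close>

text \<open>
  For \<open>p > 1\<close> the formula persists at the origin, where both \<open>inner 0 h\<close> and the true derivative vanish.
  Hence zeros of \<open>g\<close> cause no trouble when \<open>|g|\<^sup>p\<close> is differentiated.
\<close>

lemma has_derivative_norm_powr:
  fixes v :: "'a :: real_inner"
  assumes p: "1 < p"
  shows "((\<lambda>v. norm v powr p) has_derivative (\<lambda>h. p * norm v powr (p - 2) * inner v h)) (at v)"
proof (cases "v = 0")
  case True
  have "((\<lambda>h::'a. norm h powr (p - 1)) \<longlongrightarrow> 0) (at 0)"
    by (rule tendsto_zero_powrI[OF tendsto_norm_zero[OF tendsto_ident_at]]) (use p in auto)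
  moreover have "norm h powr p / norm h = norm h powr (p - 1)" for h :: 'a
    using p powr_diff[of "norm h" p 1] by (cases "h = 0") auto
  ultimately show ?thesis using True p by (simp add: has_derivative_at)
next
  case False
  have "((\<lambda>t. t powr p) has_derivative (*) (p * norm v powr (p - 1))) (at (norm v))"
    using False has_real_derivative_powr[of "norm v" p]
    by (simp add: has_field_derivative_def)
  from has_derivative_compose[OF has_derivative_norm[OF False] this]
  have "((\<lambda>v. norm v powr p) has_derivative (\<lambda>h. p * norm v powr (p - 1) * inner (sgn v) h)) (at v)"
    by (simp add: inner_commute)
  moreover have "norm v powr (p - 1) * inner (sgn v) h = norm v powr (p - 2) * inner v h" for h
    using False powr_add[of "norm v" "p - 2" 1]
    by (simp add: sgn_div_norm)
  ultimately show ?thesis by (simp add: mult.assoc)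
qed

text \<open>
  The integrand is the derivative of \<open>\<Phi> r = |g r|\<^sup>p r\<^bsup>2-p\<^esup>\<close>. For \<open>p > 2\<close> the second factor is singular at
  \<open>0\<close>; the linear bound on \<open>g\<close> gives \<open>\<Phi> r \<le> C\<^sup>p r\<^sup>2\<close>, hence continuity at \<open>0\<close>, and the
  fundamental theorem of calculus applies on \<open>[0, R]\<close>.
\<close>

lemma null_lagrangian_has_integral:
  fixes g g' :: "real \<Rightarrow> 'a :: real_inner"
  assumes p: "1 < p" and R: "0 < R"
    and deriv: "\<And>r. 0 < r \<Longrightarrow> (g has_vector_derivative g' r) (at r)"
    and lin: "\<And>r. 0 \<le> r \<Longrightarrow> norm (g r) \<le> C * r"
    and supp: "\<And>r. R \<le> r \<Longrightarrow> g r = 0"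
  shows "((\<lambda>r. (p * norm (g r /\<^sub>R r) powr (p - 2) * inner (g r /\<^sub>R r) (g' r)
             + (2 - p) * norm (g r /\<^sub>R r) powr p) * r) has_integral 0) {0<..}"
    (is "(?N has_integral 0) _")
proof -
  define \<Phi> where "\<Phi> r = norm (g r) powr p * r powr (2 - p)" for r
  have d\<Phi>: "(\<Phi> has_real_derivative ?N r) (at r)" if r: "0 < r" for r
  proof -
    have "((\<lambda>r. norm (g r) powr p) has_derivative
        (\<lambda>t. p * norm (g r) powr (p - 2) * inner (g r) (t *\<^sub>R g' r))) (at r)"
      using has_derivative_compose[OF _ has_derivative_norm_powr[OF p]] deriv[OF r]
      unfolding has_vector_derivative_def by blast
    then have "((\<lambda>r. norm (g r) powr p) has_real_derivative
        p * norm (g r) powr (p - 2) * inner (g r) (g' r)) (at r)"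
      unfolding has_field_derivative_def by (rule has_derivative_eq_rhs) (auto simp: mult_ac)
    from DERIV_mult[OF this has_real_derivative_powr[OF r, of "2 - p"]]
    have "(\<Phi> has_real_derivative
        p * norm (g r) powr (p - 2) * inner (g r) (g' r) * r powr (2 - p)
        + (2 - p) * r powr (2 - p - 1) * norm (g r) powr p) (at r)"
      unfolding \<Phi>_def .
    moreover have "norm (g r /\<^sub>R r) powr (p - 2) = norm (g r) powr (p - 2) * r powr (2 - p)"
      "norm (g r /\<^sub>R r) powr p * r = norm (g r) powr p * r powr (2 - p - 1)"
    proof -
      have "norm (g r /\<^sub>R r) = norm (g r) / r"
        using r by (simp add: divide_inverse mult.commute)
      then have n: "norm (g r /\<^sub>R r) powr q = norm (g r) powr q * r powr (- q)" for q
        using r by (simp add: powr_divide powr_minus_divide)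
      have "r powr (1 - p) = r powr (- p) * r" using r powr_add[of r "- p" 1] by simp
      then show "norm (g r /\<^sub>R r) powr (p - 2) = norm (g r) powr (p - 2) * r powr (2 - p)"
        "norm (g r /\<^sub>R r) powr p * r = norm (g r) powr p * r powr (2 - p - 1)"
        unfolding n by simp_all
    qed
    moreover have "inner (g r /\<^sub>R r) (g' r) * r = inner (g r) (g' r)"
      using r by simp
    moreover have "?N r = p * norm (g r /\<^sub>R r) powr (p - 2) * (inner (g r /\<^sub>R r) (g' r) * r)
        + (2 - p) * (norm (g r /\<^sub>R r) powr p * r)"
      by (simp only: distrib_right mult.assoc)
    ultimately show ?thesis by (simp only: mult_ac)
  qed
  have "continuous_on {0..R} \<Phi>"
    unfolding continuous_on_eq_continuous_within
  proof
    fix r assume r: "r \<in> {0..R}"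
    show "continuous (at r within {0..R}) \<Phi>"
    proof (cases "r = 0")
      case False
      then show ?thesis
        using r d\<Phi>[of r] by (auto intro: DERIV_continuous continuous_at_imp_continuous_at_within)
    next
      case True
      have le: "norm (\<Phi> s) \<le> C powr p * s\<^sup>2" if "0 \<le> s" for s
      proof (cases "s = 0")
        case False
        with that have s: "0 < s" by simp
        have C: "0 \<le> C" using order_trans[OF norm_ge_zero lin[OF that]] s
          by (simp add: zero_le_mult_iff)
        have "norm (g s) powr p \<le> (C * s) powr p"
          using lin[OF that] p by (intro powr_mono2) auto
        then have "\<Phi> s \<le> (C * s) powr p * s powr (2 - p)"
          unfolding \<Phi>_def by (rule mult_right_mono) simp
        also have "\<dots> = C powr p * s\<^sup>2"
          using s C powr_add[of s p "2 - p"] by (simp add: powr_mult)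
        finally show ?thesis by (simp add: \<Phi>_def)
      qed (simp add: \<Phi>_def)
      have "(\<Phi> \<longlongrightarrow> 0) (at 0 within {0..R})"
      proof (rule Lim_null_comparison)
        show "\<forall>\<^sub>F s in at 0 within {0..R}. norm (\<Phi> s) \<le> C powr p * s\<^sup>2"
          using le by (auto simp: eventually_at_filter)
        show "((\<lambda>s. C powr p * s\<^sup>2) \<longlongrightarrow> 0) (at 0 within {0..R})"
          by (auto intro!: tendsto_eq_intros)
      qed
      then show ?thesis using True by (simp add: continuous_within \<Phi>_def)
    qed
  qed
  then have "(?N has_integral (\<Phi> R - \<Phi> 0)) {0..R}"
    using R d\<Phi>
    by (intro fundamental_theorem_of_calculus_interior)
       (auto simp: has_real_derivative_iff_has_vector_derivative)
  moreover have "\<Phi> R = 0" "\<Phi> 0 = 0" using supp[of R] by (auto simp: \<Phi>_def)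
  ultimately have int: "(?N has_integral 0) {0..R}" by simp
  have e1: "{r \<in> {0..R} - {0<..}. ?N r \<noteq> 0} = {}" by auto
  have e2: "{r \<in> {0<..} - {0..R}. ?N r \<noteq> 0} = {}"
  proof -
    have "?N r = 0" if "r \<in> {0<..} - {0..R}" for r
    proof -
      have "g r = 0" using supp[of r] that by auto
      then show ?thesis by simp
    qed
    then show ?thesis by blast
  qed
  have "(?N has_integral 0) {0..R} \<longleftrightarrow> (?N has_integral 0) {0<..}"
    by (rule has_integral_spike_set_eq) (simp_all only: e1 e2 negligible_empty)
  with int show ?thesis by blast
qed

section \<open>Integration over the half-line\<close>

lemma set_integrable_Ioi_bounded_support:
  fixes f :: "real \<Rightarrow> real"
  assumes cont: "continuous_on {0<..} f"
    and bound: "\<And>r. 0 < r \<Longrightarrow> r \<le> R \<Longrightarrow> \<bar>f r\<bar> \<le> B"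
    and supp: "\<And>r. R < r \<Longrightarrow> f r = 0"
  shows "set_integrable lborel {0<..} f"
  unfolding set_integrable_def
proof (rule integrableI_bounded_set[where A = "{0<..R}" and B = B])
  show "(\<lambda>r. indicator {0<..} r *\<^sub>R f r) \<in> borel_measurable lborel"
    using borel_measurable_continuous_on_indicator[OF _ cont] by simp
  show "emeasure lborel {0<..R} < \<infinity>"
    by (cases "0 \<le> R") auto
  show "AE r in lborel. r \<in> {0<..R} \<longrightarrow> norm (indicator {0<..} r *\<^sub>R f r) \<le> B"
    using bound by auto
  show "AE r in lborel. r \<notin> {0<..R} \<longrightarrow> indicator {0<..} r *\<^sub>R f r = 0"
    using supp by (auto simp: indicator_def)
qed auto

lemma complex_stretch_has_vector_derivative:
  assumes "complex_stretch g" "0 \<le> r"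
  shows "(g has_vector_derivative deriv_halfline g r) (at r within {0..})"
proof -
  have "(deriv_halfline ^^ 0) g differentiable_on {0..}"
    using assms unfolding complex_stretch_def smooth_halfline_def by blast
  then show ?thesis
    using assms(2) unfolding deriv_halfline_def
    by (auto simp: differentiable_on_def simp flip: vector_derivative_works)
qed

text \<open>
  The derivative is continuous up to \<open>0\<close> and has bounded support, hence is bounded; the mean value
  inequality from \<open>g 0 = 0\<close> turns this into the linear bound on \<open>g\<close>, which controls \<open>g r / r\<close> near \<open>0\<close>.
  Taking \<open>R\<close> beyond the support gives the derivative the value \<open>0\<close> at \<open>R\<close> too.
\<close>

lemma complex_stretch_bounds:
  assumes g: "complex_stretch g"
  obtains R C where "0 < R" "\<And>r. R \<le> r \<Longrightarrow> g r = 0" "\<And>r. R \<le> r \<Longrightarrow> deriv_halfline g r = 0"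
    "\<And>r. 0 \<le> r \<Longrightarrow> norm (g r) \<le> C * r" "\<And>r. 0 \<le> r \<Longrightarrow> norm (deriv_halfline g r) \<le> C"
proof -
  note deriv = complex_stretch_has_vector_derivative[OF g]
  obtain R0 where R0: "\<And>r. 0 \<le> r \<Longrightarrow> R0 < r \<Longrightarrow> g r = 0"
    using g unfolding complex_stretch_def compact_support_halfline_iff by blast
  define R where "R = max R0 0 + 1"
  have gR: "g r = 0" if "R \<le> r" for r
    using R0[of r] that by (auto simp: R_def)
  have dR: "deriv_halfline g r = 0" if "R \<le> r" for r
  proof -
    have r: "0 < r" "R0 < r" using that by (auto simp: R_def)
    have "(g has_vector_derivative deriv_halfline g r) (at r)"
      using deriv[of r] r at_within_interior[of r "{0..}"] by simp
    moreover have "(g has_vector_derivative 0) (at r)"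
    proof (rule has_vector_derivative_transform_within_open)
      show "((\<lambda>_. 0) has_vector_derivative 0) (at r)" by simp
      show "open {max R0 0<..}" "r \<in> {max R0 0<..}" using r by auto
      show "\<And>x. x \<in> {max R0 0<..} \<Longrightarrow> 0 = g x" using R0 by auto
    qed
    ultimately show ?thesis by (rule vector_derivative_unique_at)
  qed
  have "continuous_on {0..} (deriv_halfline g)"
  proof -
    have "(deriv_halfline ^^ 1) g differentiable_on {0..}"
      using g unfolding complex_stretch_def smooth_halfline_def by blast
    then show ?thesis by (simp add: differentiable_imp_continuous_on)
  qed
  then have "compact (deriv_halfline g ` {0..R})"
    by (intro compact_continuous_image) (auto intro: continuous_on_subset)
  then obtain C where C: "\<And>r. r \<in> {0..R} \<Longrightarrow> norm (deriv_halfline g r) \<le> C"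
    using compact_imp_bounded bounded_iff by (metis imageI)
  have "0 < R" by (simp add: R_def)
  then have "0 \<le> C" using order_trans[OF norm_ge_zero C[of 0]] by simp
  then have dC: "norm (deriv_halfline g r) \<le> C" if "0 \<le> r" for r
    using that dR[of r] C[of r] by (cases "r \<le> R") auto
  have "norm (g r) \<le> C * r" if r: "0 \<le> r" for r
  proof -
    have "norm (g r - g 0) \<le> C * norm (r - 0)"
    proof (rule differentiable_bound[where S = "{0..}" and f' = "\<lambda>x t. t *\<^sub>R deriv_halfline g x"])
      show "(g has_derivative (\<lambda>t. t *\<^sub>R deriv_halfline g x)) (at x within {0..})" if "x \<in> {0..}" for x
        using deriv[of x] that by (simp add: has_vector_derivative_def)
      show "onorm (\<lambda>t. t *\<^sub>R deriv_halfline g x) \<le> C" if "x \<in> {0..}" for x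
        using dC[of x] that by (intro onorm_le) (simp add: mult_left_mono mult.commute[of C])
    qed (use r in auto)
    then show ?thesis using g r by (simp add: complex_stretch_def)
  qed
  with that[of R C] dC dR gR \<open>0 < R\<close> show thesis by blast
qed

theorem mainTheorem2:
  fixes p :: real and g :: "real \<Rightarrow> complex"
  assumes "1 < p" and "complex_stretch g"
  shows "(LBINT r=0..\<infinity>. norm (deriv_halfline g r - g r / of_real r) powr p * r)
     \<le> (conj_max p - 1) powr p *
       (LBINT r=0..\<infinity>. norm (deriv_halfline g r + g r / of_real r) powr p * r)"
proof -
  note p = \<open>1 < p\<close> and g = \<open>complex_stretch g\<close>
  define c where "c = (conj_max p - 1) powr p"
  define a where "a = deriv_halfline g"
  define b where "b r = g r / of_real r" for r
  have b: "b r = g r /\<^sub>R r" for r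
    by (simp add: b_def scaleR_conv_of_real divide_inverse mult.commute)
  obtain R C where R: "0 < R" "\<And>r. R \<le> r \<Longrightarrow> g r = 0" "\<And>r. R \<le> r \<Longrightarrow> a r = 0"
    and C: "\<And>r. 0 \<le> r \<Longrightarrow> norm (g r) \<le> C * r" "\<And>r. 0 \<le> r \<Longrightarrow> norm (a r) \<le> C"
    using complex_stretch_bounds[OF g] unfolding a_def by metis
  have deriv: "(g has_vector_derivative a r) (at r)" if "0 < r" for r
    using complex_stretch_has_vector_derivative[OF g, of r] that at_within_interior[of r "{0..}"]
    by (simp add: a_def)
  have "(deriv_halfline ^^ 1) g differentiable_on {0..}"
    using g unfolding complex_stretch_def smooth_halfline_def by blast
  then have "continuous_on {0..} a" by (simp add: differentiable_imp_continuous_on a_def)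
  then have conta: "continuous_on {0<..} a" by (rule continuous_on_subset) auto
  have contg: "continuous_on {0<..} g"
    using deriv by (auto intro!: continuous_at_imp_continuous_on has_vector_derivative_continuous)
  have contb: "continuous_on {0<..} b"
    unfolding b_def using contg by (intro continuous_intros) auto
  \<comment> \<open>The sign \<open>\<epsilon>\<close> covers the integrands of both sides of the theorem at once.\<close>
  have int: "set_integrable lborel {0<..} (\<lambda>r. norm (a r + \<epsilon> *\<^sub>R b r) powr p * r)"
    if "\<bar>\<epsilon>\<bar> = 1" for \<epsilon>
  proof (rule set_integrable_Ioi_bounded_support)
    show "continuous_on {0<..} (\<lambda>r. norm (a r + \<epsilon> *\<^sub>R b r) powr p * r)"
      using p conta contb by (intro continuous_intros continuous_on_powr') auto
    show "\<bar>norm (a r + \<epsilon> *\<^sub>R b r) powr p * r\<bar> \<le> (2 * C) powr p * R" if r: "0 < r" "r \<le> R" for r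
    proof -
      have "norm (b r) \<le> C" using C(1)[of r] r by (simp add: b_def norm_divide divide_le_eq)
      then have "norm (a r + \<epsilon> *\<^sub>R b r) \<le> 2 * C"
        using norm_triangle_ineq[of "a r" "\<epsilon> *\<^sub>R b r"] C(2)[of r] r \<open>\<bar>\<epsilon>\<bar> = 1\<close> by simp
      then have "norm (a r + \<epsilon> *\<^sub>R b r) powr p * r \<le> (2 * C) powr p * R"
        using r p by (intro mult_mono powr_mono2) auto
      then show ?thesis using r by (simp add: abs_mult)
    qed
    show "norm (a r + \<epsilon> *\<^sub>R b r) powr p * r = 0" if "R < r" for r
      using R that p by (simp add: b_def)
  qed
  define A where "A r = norm (a r - b r) powr p * r" for r
  define B where "B r = norm (a r + b r) powr p * r" for r
  have iA: "set_integrable lborel {0<..} A" using int[of "-1"] by (simp add: A_def[abs_def])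
  have iB: "set_integrable lborel {0<..} B" using int[of 1] by (simp add: B_def[abs_def])
  have "(A has_integral integral {0<..} A) {0<..}" "(B has_integral integral {0<..} B) {0<..}"
    using iA iB set_borel_integral_eq_integral(1) by blast+
  then have AB: "((\<lambda>r. A r - c * B r) has_integral
      (integral {0<..} A - c * integral {0<..} B)) {0<..}"
    by (intro has_integral_diff has_integral_mult_right)
  obtain K where K: "\<And>a b :: complex. norm (a - b) powr p - c * norm (a + b) powr p
      \<le> - K * (p * norm b powr (p - 2) * inner b a + (2 - p) * norm b powr p)"
    using stretch_pointwise[OF p] unfolding c_def by blast
  have "((\<lambda>r. - K * ((p * norm (b r) powr (p - 2) * inner (b r) (a r)
      + (2 - p) * norm (b r) powr p) * r)) has_integral - K * 0) {0<..}"
    unfolding b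
    by (intro has_integral_mult_right null_lagrangian_has_integral[OF p R(1) deriv C(1) R(2)])
  from has_integral_le[OF AB this]
  have "integral {0<..} A - c * integral {0<..} B \<le> 0"
    using mult_right_mono[OF K] by (force simp: A_def B_def algebra_simps)
  then show ?thesis
    using set_borel_integral_eq_integral(2)[OF iA] set_borel_integral_eq_integral(2)[OF iB]
    by (simp add: interval_lebesgue_integral_0_infty A_def B_def a_def b_def c_def)
qed

end
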